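(* Let $\mathcal{Y}=\{\bm{y}_1,\bm{y}_2,\dots\}\subseteq\{0,1\}^L$ with $|\mathcal{Y}|\ge2$ and $\|\bm{y}\|=r$ for all $\bm{y}\in\mathcal{Y}$, for some $r>0$. Let $\Omega$ be the SparseMAP regularizer in one of the two cases: (a) no high order interactions, $\Omega(\bm{y})=\frac12\|\bm{y}\|^2+I_{\mathrm{conv}(\mathcal{Y})}(\bm{y})$; or (b) high order interactions, $\bm{y}=[\bm{y}_V;\bm{y}_F]$, $\Omega(\bm{y})=\frac12\|\bm{y}_V\|^2+I_{\mathrm{conv}(\mathcal{Y})}(\bm{y})$, where $\|\bm{y}_V\|=r_V$ and $\|\bm{y}_F\|=r_F$ for all $\bm{y}\in\mathcal{Y}$, with $r_V^2+r_F^2=r^2$. Let $\bm{X}\in\mathbb{R}^{L\times D}$ have rows $\bm{x}_1,\dots,\bm{x}_L$, let $\beta>0$, and consider the structured Hopfield updates $$\bm{q}^{(t+1)}=\bm{X}^\top\mathrm{SparseMAP}(\beta\bm{X}\bm{q}^{(t)}).$$ For $\bm{y}_i\in\mathcal{Y}$ let $\Delta_i=\bm{y}_i^\top\bm{X}\bm{X}^\top\bm{y}_i-\max_{j\ne i}\bm{y}_i^\top\bm{X}\bm{X}^\top\bm{y}_j$ and $D_i=\max_j\|\bm{y}_i-\bm{y}_j\|\le2r$. Let $\bm{y}_i\in\mathcal{Y}$ be such that $\Delta_i\ge\frac{D_i^2}{2\beta}$. Then: (1) $\bm{X}^\top\bm{y}_i$ is a stationary point of the Hopfield energy. (2) If $\bm{q}^{(0)}\in\mathbb{R}^D$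 satisfies ${\bm{q}^{(0)}}^\top\bm{X}^\top(\bm{y}_i-\bm{y}_j)\ge\frac{D_i^2}{2\beta}$ for all $j\ne i$, then the updates converge to the pattern association $\bm{X}^\top\bm{y}_i$ in one iteration, i.e. $\bm{q}^{(t)}=\bm{X}^\top\bm{y}_i$ for all $t\ge1$. (3) Moreover, if for some $\epsilon\ge0$ $$\Delta_i\ge\frac{D_i^2}{2\beta}+\epsilon\min\{\sigma_{\max}(\bm{X})D_i,\;MD_i^2\},$$ where $\sigma_{\max}(\bm{X})$ is the spectral norm of $\bm{X}$ and $M=\max_k\|\bm{x}_k\|$, then for any $\bm{q}^{(0)}$ with $\|\bm{q}^{(0)}-\bm{X}^\top\bm{y}_i\|\le\epsilon$ the updates converge to $\bm{X}^\top\bm{y}_i$ in one iteration, i.e. $\bm{q}^{(t)}=\bm{X}^\top\bm{y}_i$ for all $t\ge1$.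
   Context: $\|\cdot\|$ is the Euclidean norm, $\mathrm{conv}(\mathcal{Y})$ is the convex hull, and $I_{\mathcal{C}}$ is the indicator function of a convex set ($0$ on $\mathcal{C}$, $+\infty$ outside). The elements of $\mathcal{Y}$ are enumerated as $\bm{y}_1,\bm{y}_2,\dots$ without repetition, and $j$ ranges over this enumeration. In case (b), the coordinates are partitioned into a block $V$ (variable nodes of a factor graph) and a block $F$ (factor nodes), and only the $V$ block is regularized. SparseMAP: $\mathrm{SparseMAP}(\bm{\theta})=\hat{\bm{y}}_\Omega(\bm{\theta})$, a maximizer of $\bm{\theta}^\top\bm{y}-\Omega(\bm{y})$ over $\bm{y}\in\mathrm{conv}(\mathcal{Y})$ (unique in case (a); in case (b), any maximizer may be taken). Hopfield energy: up to an additive constant, $E(\bm{q})=-\beta^{-1}\Omega^*(\beta\bm{X}\bm{q})+\frac12\|\bm{q}\|^2$ with $\Omega^*(\bm{\theta})=\max_{\bm{y}\in\mathrm{conv}(\mathcal{Y})}\bm{\theta}^\top\bm{y}-\Omega(\bm{y})$. A point $\bm{q}$ is stationary iff $\bm{q}=\bm{X}^\top\mathrm{SparseMAP}(\beta\bm{X}\bm{q})$. A pattern association is a vector of the form $\bm{X}^\top\bm{y}$ with $\bm{y}\in\mathcal{Y}$. *)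

theory Defs
  imports "HOL-Analysis.Analysis"
begin

definition convex_indicator :: "'a set \<Rightarrow> 'a \<Rightarrow> ereal" where
  "convex_indicator C y = (if y \<in> C then 0 else \<infinity>)"

text \<open>The sub-vector of \<open>y\<close> on the coordinates in \<open>V\<close> is represented by zero padding, which
  leaves its Euclidean norm unchanged.\<close>

definition block :: "'l set \<Rightarrow> real ^ 'l \<Rightarrow> real ^ 'l" where
  "block V y = (\<chi> k. if k \<in> V then y $ k else 0)"

definition sparsemap_reg :: "(real ^ 'l) set \<Rightarrow> real ^ 'l \<Rightarrow> ereal" where
  "sparsemap_reg Y y = ereal (1/2 * (norm y)\<^sup>2) + convex_indicator (convex hull Y) y"

definition sparsemap_reg_high :: "'l set \<Rightarrow> (real ^ 'l) set \<Rightarrow> real ^ 'l \<Rightarrow> ereal" where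
  "sparsemap_reg_high V Y y =
     ereal (1/2 * (norm (block V y))\<^sup>2) + convex_indicator (convex hull Y) y"

text \<open>Maximizers need not be unique when only a block is regularized, so SparseMAP is treated
  as an arbitrary function selecting a maximizer at every \<open>\<theta>\<close>.\<close>

definition is_sparsemap ::
  "(real ^ 'l \<Rightarrow> ereal) \<Rightarrow> (real ^ 'l) set \<Rightarrow> (real ^ 'l \<Rightarrow> real ^ 'l) \<Rightarrow> bool" where
  "is_sparsemap \<Omega> Y S \<longleftrightarrow>
     (\<forall>\<theta>. is_arg_max (\<lambda>y. ereal (\<theta> \<bullet> y) - \<Omega> y) (\<lambda>y. y \<in> convex hull Y) (S \<theta>))"

definition conjugate_reg ::
  "(real ^ 'l \<Rightarrow> ereal) \<Rightarrow> (real ^ 'l) set \<Rightarrow> real ^ 'l \<Rightarrow> ereal" where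
  "conjugate_reg \<Omega> Y \<theta> = (SUP y \<in> convex hull Y. ereal (\<theta> \<bullet> y) - \<Omega> y)"

text \<open>\<open>real_of_ereal\<close> loses nothing for the two regularizers above: for finite nonempty \<open>Y\<close>
  the supremum is a maximum of a continuous real function over a compact set.\<close>

definition hopfield_energy ::
  "(real ^ 'l \<Rightarrow> ereal) \<Rightarrow> (real ^ 'l) set \<Rightarrow> real \<Rightarrow> real ^ 'd ^ 'l \<Rightarrow> real ^ 'd \<Rightarrow> real" where
  "hopfield_energy \<Omega> Y \<beta> X q =
     - inverse \<beta> * real_of_ereal (conjugate_reg \<Omega> Y (\<beta> *\<^sub>R (X *v q))) + 1/2 * (norm q)\<^sup>2"

definition stationary_point :: "('a::real_normed_vector \<Rightarrow> real) \<Rightarrow> 'a \<Rightarrow> bool" where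
  "stationary_point f q \<longleftrightarrow> (f has_derivative (\<lambda>_. 0)) (at q)"

definition hopfield_map ::
  "(real ^ 'l \<Rightarrow> real ^ 'l) \<Rightarrow> real \<Rightarrow> real ^ 'd ^ 'l \<Rightarrow> real ^ 'd \<Rightarrow> real ^ 'd" where
  "hopfield_map S \<beta> X q = transpose X *v S (\<beta> *\<^sub>R (X *v q))"

definition hopfield_updates ::
  "(real ^ 'l \<Rightarrow> real ^ 'l) \<Rightarrow> real \<Rightarrow> real ^ 'd ^ 'l \<Rightarrow> (nat \<Rightarrow> real ^ 'd) \<Rightarrow> bool" where
  "hopfield_updates S \<beta> X q \<longleftrightarrow> (\<forall>t. q (Suc t) = hopfield_map S \<beta> X (q t))"

text \<open>An enumeration of \<open>Y\<close> without repetition turns \<open>j \<noteq> i\<close> into membership in \<open>Y - {y}\<close>.\<close>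

definition separation :: "(real ^ 'l) set \<Rightarrow> real ^ 'd ^ 'l \<Rightarrow> real ^ 'l \<Rightarrow> real" where
  "separation Y X y =
     y \<bullet> ((X ** transpose X) *v y) - Max ((\<lambda>y'. y \<bullet> ((X ** transpose X) *v y')) ` (Y - {y}))"

definition max_dist :: "(real ^ 'l) set \<Rightarrow> real ^ 'l \<Rightarrow> real" where
  "max_dist Y y = Max ((\<lambda>y'. norm (y - y')) ` Y)"

definition spectral_norm :: "real ^ 'd ^ 'l \<Rightarrow> real" where
  "spectral_norm X = onorm ((*v) X)"

definition max_row_norm :: "real ^ 'd ^ 'l \<Rightarrow> real" where
  "max_row_norm X = Max (range (\<lambda>k. norm (row k X)))"

end

theory Submission
  imports Defs
begin

text \<open>Write \<open>P\<close> and \<open>Q\<close> for the projections to the regularized block and to its complement.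
  Since \<open>P\<close> has constant norm on \<open>Y\<close>, \<open>P y\<^sub>i \<bullet> (y\<^sub>i - y) = 1/2 * \<parallel>P (y\<^sub>i - y)\<parallel>\<^sup>2\<close> for
  \<open>y \<in> Y\<close>. If \<open>\<theta> \<bullet> (y\<^sub>i - y) \<ge> D\<^sub>i\<^sup>2 / 2\<close> for all \<open>y \<noteq> y\<^sub>i\<close>, then
  \<open>(\<theta> - P y\<^sub>i) \<bullet> (y\<^sub>i - y) \<ge> 1/2 * \<parallel>Q (y\<^sub>i - y)\<parallel>\<^sup>2\<close> on \<open>Y\<close>; this inequality is preserved by convex
  combinations, so it holds on the convex hull. There it says that the objective drops by at least
  \<open>1/2 * \<parallel>y\<^sub>i - y\<parallel>\<^sup>2\<close> away from \<open>y\<^sub>i\<close>. Hence \<open>y\<^sub>i\<close> is the only maximizer, in both cases, and the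
  same quadratic growth makes \<open>\<Omega>\<^sup>*\<close> differentiable at \<open>\<theta>\<close> with gradient \<open>y\<^sub>i\<close>.\<close>

section \<open>Block projections and convex quadratic sublevel sets\<close>

lemma inner_transpose_mult: "(transpose A *v x) \<bullet> y = x \<bullet> (A *v y)"
  for A :: "real ^ 'm ^ 'n"
  by (simp add: dot_lmul_matrix)

lemma linear_block: "linear (block V)"
  by (rule linearI) (auto simp: block_def vec_eq_iff)

lemma block_UNIV: "block UNIV y = y"
  by (simp add: block_def vec_eq_iff)

lemma inner_block_left: "block V x \<bullet> y = block V x \<bullet> block V y"
  by (auto simp: block_def inner_vec_def intro!: sum.cong)

lemma norm_block_split: "(norm y)\<^sup>2 = (norm (block V y))\<^sup>2 + (norm (block (- V) y))\<^sup>2"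
  unfolding power2_norm_eq_inner inner_vec_def sum.distrib[symmetric]
  by (rule sum.cong) (auto simp: block_def)

text \<open>Case (a) becomes case (b) with all coordinates regularized, so one argument serves
  both.\<close>

lemma sparsemap_reg_eq_high: "sparsemap_reg Y = sparsemap_reg_high UNIV Y"
  by (simp add: fun_eq_iff sparsemap_reg_def sparsemap_reg_high_def block_UNIV)

lemma half_norm_diff_power2:
  fixes a b :: "'a::real_inner"
  shows "1/2 * (norm b)\<^sup>2 - 1/2 * (norm a)\<^sup>2 = 1/2 * (norm (a - b))\<^sup>2 - a \<bullet> (a - b)"
  by (simp add: power2_norm_eq_inner algebra_simps inner_commute)

text \<open>A convex quadratic minus an affine function is convex. This carries an inequality
  checked on \<open>Y\<close> over to its convex hull.\<close>

lemma convex_norm_power2_sublevel: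
  fixes f :: "'a::real_inner \<Rightarrow> 'b::real_inner"
  assumes "linear f"
  shows "convex {y. 1/2 * (norm (f (a - y)))\<^sup>2 \<le> w \<bullet> (a - y)}"
proof (rule convexI)
  fix x y and u v :: real
  assume x: "x \<in> {y. 1/2 * (norm (f (a - y)))\<^sup>2 \<le> w \<bullet> (a - y)}"
    and y: "y \<in> {y. 1/2 * (norm (f (a - y)))\<^sup>2 \<le> w \<bullet> (a - y)}"
    and uv: "0 \<le> u" "0 \<le> v" "u + v = 1"
  define p q where "p = f (a - x)" and "q = f (a - y)"
  have comb: "a - (u *\<^sub>R x + v *\<^sub>R y) = u *\<^sub>R (a - x) + v *\<^sub>R (a - y)"
    using uv(3) by (simp add: algebra_simps flip: scaleR_add_left)
  have f_comb: "f (a - (u *\<^sub>R x + v *\<^sub>R y)) = u *\<^sub>R p + v *\<^sub>R q"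
    unfolding comb p_def q_def by (simp add: linear_add[OF assms] linear_scale[OF assms])
  have v: "v = 1 - u" using uv(3) by simp
  \<comment> \<open>The exact convexity defect of the squared norm.\<close>
  have "u * (norm p)\<^sup>2 + v * (norm q)\<^sup>2 - (norm (u *\<^sub>R p + v *\<^sub>R q))\<^sup>2 = u * v * (norm (p - q))\<^sup>2"
    unfolding v by (simp add: power2_norm_eq_inner algebra_simps inner_commute)
  moreover have "0 \<le> u * v * (norm (p - q))\<^sup>2" using uv by simp
  ultimately have "1/2 * (norm (u *\<^sub>R p + v *\<^sub>R q))\<^sup>2
      \<le> u * (1/2 * (norm p)\<^sup>2) + v * (1/2 * (norm q)\<^sup>2)" by linarith
  also have "\<dots> \<le> u * (w \<bullet> (a - x)) + v * (w \<bullet> (a - y))"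
    using x y uv by (intro add_mono mult_left_mono) (auto simp: p_def q_def)
  also have "\<dots> = w \<bullet> (a - (u *\<^sub>R x + v *\<^sub>R y))"
    unfolding comb by (simp add: inner_add_right)
  finally show "u *\<^sub>R x + v *\<^sub>R y \<in> {y. 1/2 * (norm (f (a - y)))\<^sup>2 \<le> w \<bullet> (a - y)}"
    by (simp add: f_comb)
qed

section \<open>Quadratic growth of the objective and its consequences\<close>

definition objective :: "'l set \<Rightarrow> real ^ 'l \<Rightarrow> real ^ 'l \<Rightarrow> real" where
  "objective V \<theta> y = \<theta> \<bullet> y - 1/2 * (norm (block V y))\<^sup>2"

text \<open>The indicator vanishes on the hull, so the later estimates can be made over
  \<open>real\<close>.\<close>

lemma ereal_objective:
  assumes "y \<in> convex hull Y"
  shows "ereal (\<theta> \<bullet> y) - sparsemap_reg_high V Y y = ereal (objective V \<theta> y)"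
  using assms by (simp add: sparsemap_reg_high_def convex_indicator_def objective_def)

lemma is_sparsemapD:
  assumes "is_sparsemap (sparsemap_reg_high V Y) Y S"
  shows "S \<theta> \<in> convex hull Y"
    and "y \<in> convex hull Y \<Longrightarrow> objective V \<theta> y \<le> objective V \<theta> (S \<theta>)"
proof -
  have max: "is_arg_max (\<lambda>y. ereal (\<theta> \<bullet> y) - sparsemap_reg_high V Y y)
      (\<lambda>y. y \<in> convex hull Y) (S \<theta>)"
    using assms by (simp add: is_sparsemap_def)
  then show mem: "S \<theta> \<in> convex hull Y" by (simp add: is_arg_max_def)
  show "objective V \<theta> y \<le> objective V \<theta> (S \<theta>)" if "y \<in> convex hull Y"
    using max that mem by (auto simp: is_arg_max_def ereal_objective not_less)
qed

lemma conjugate_reg_eq: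
  assumes "is_sparsemap (sparsemap_reg_high V Y) Y S"
  shows "conjugate_reg (sparsemap_reg_high V Y) Y \<theta> = ereal (objective V \<theta> (S \<theta>))"
  unfolding conjugate_reg_def using is_sparsemapD[OF assms, where \<theta>=\<theta>]
  by (intro antisym SUP_least)
    (auto simp: ereal_objective intro!: SUP_upper2[of "S \<theta>"])

lemma objective_quadratic_growth:
  assumes norm_block: "\<And>y. y \<in> Y \<Longrightarrow> norm (block V y) = rV"
    and yi: "yi \<in> Y"
    and dist: "\<And>y. y \<in> Y \<Longrightarrow> norm (yi - y) \<le> D"
    and gap: "\<And>y. y \<in> Y - {yi} \<Longrightarrow> D\<^sup>2 / 2 \<le> \<theta> \<bullet> (yi - y)"
    and y: "y \<in> convex hull Y"
  shows "1/2 * (norm (yi - y))\<^sup>2 \<le> objective V \<theta> yi - objective V \<theta> y"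
proof -
  have diff: "block V (yi - z) = block V yi - block V z" for z
    by (rule linear_diff[OF linear_block])
  have half: "1/2 * (norm (block V z))\<^sup>2 - 1/2 * (norm (block V yi))\<^sup>2
      = 1/2 * (norm (block V (yi - z)))\<^sup>2 - block V yi \<bullet> (yi - z)" for z
    unfolding inner_block_left[of V yi "yi - z"] diff by (rule half_norm_diff_power2)
  \<comment> \<open>Only the complementary block enters \<open>?C\<close>: the \<open>V\<close> part
    is governed by the identity \<open>half\<close>, valid at every point.\<close>
  let ?C = "{z. 1/2 * (norm (block (- V) (yi - z)))\<^sup>2 \<le> (\<theta> - block V yi) \<bullet> (yi - z)}"
  have "z \<in> ?C" if z: "z \<in> Y" for z
  proof (cases "z = yi")
    case True
    then show ?thesis by (simp add: linear_0[OF linear_block])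
  next
    case False
    have "(norm (yi - z))\<^sup>2 \<le> D\<^sup>2" using dist[OF z] by (simp add: power_mono)
    with gap[of z] z False have "1/2 * (norm (yi - z))\<^sup>2 \<le> \<theta> \<bullet> (yi - z)" by auto
    \<comment> \<open>Equal block norms make the left side of \<open>half\<close> zero here.\<close>
    with half[of z] norm_block[OF z] norm_block[OF yi] norm_block_split[of "yi - z" V]
    show ?thesis by (simp add: inner_diff_left)
  qed
  then have "convex hull Y \<subseteq> ?C"
    by (intro hull_minimal convex_norm_power2_sublevel linear_block) auto
  with y have "1/2 * (norm (block (- V) (yi - y)))\<^sup>2 \<le> (\<theta> - block V yi) \<bullet> (yi - y)"
    by auto
  \<comment> \<open>Off \<open>Y\<close> the block norms may differ, but that difference is exactly
    what the objective contains.\<close>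
  then show ?thesis
    using half[of y] norm_block_split[of "yi - y" V]
    by (simp add: objective_def inner_diff_left inner_diff_right)
qed

lemma sparsemap_eq_of_growth:
  assumes S: "is_sparsemap (sparsemap_reg_high V Y) Y S"
    and yi: "yi \<in> convex hull Y"
    and growth: "\<And>y. y \<in> convex hull Y \<Longrightarrow>
      1/2 * (norm (yi - y))\<^sup>2 \<le> objective V \<theta> yi - objective V \<theta> y"
  shows "S \<theta> = yi"
proof -
  have "(norm (yi - S \<theta>))\<^sup>2 \<le> 0"
    using growth[OF is_sparsemapD(1)[OF S, of \<theta>]] is_sparsemapD(2)[OF S yi, of \<theta>] by linarith
  then show ?thesis by simp
qed

text \<open>Growth at \<open>\<theta>\<close> is played against optimality of
  \<open>S \<eta>\<close> at \<open>\<eta>\<close>: the quadratic terms cancel and leave a term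
  linear in \<open>\<eta> - \<theta>\<close>. The factor 2 undoes the 1/2 in the growth.\<close>

lemma sparsemap_lipschitz_of_growth:
  assumes S: "is_sparsemap (sparsemap_reg_high V Y) Y S"
    and yi: "yi \<in> convex hull Y"
    and growth: "\<And>y. y \<in> convex hull Y \<Longrightarrow>
      1/2 * (norm (yi - y))\<^sup>2 \<le> objective V \<theta> yi - objective V \<theta> y"
  shows "norm (S \<eta> - yi) \<le> 2 * norm (\<eta> - \<theta>)"
proof -
  let ?n = "norm (S \<eta> - yi)"
  have "1/2 * ?n\<^sup>2 \<le> objective V \<theta> yi - objective V \<theta> (S \<eta>)"
    using growth[OF is_sparsemapD(1)[OF S, of \<eta>]] by (simp add: norm_minus_commute)
  also have "\<dots> \<le> (\<eta> - \<theta>) \<bullet> (S \<eta> - yi)"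
    using is_sparsemapD(2)[OF S yi, of \<eta>]
    by (simp add: objective_def inner_diff_left inner_diff_right)
  also have "\<dots> \<le> norm (\<eta> - \<theta>) * ?n" by (rule norm_cauchy_schwarz)
  finally have "?n * ?n \<le> (2 * norm (\<eta> - \<theta>)) * ?n" by (simp add: power2_eq_square)
  then show ?thesis
    by (cases "?n = 0") (auto simp: mult_le_cancel_right)
qed

text \<open>An envelope argument. Testing \<open>yi\<close> at \<open>\<eta>\<close> bounds the
  remainder below by 0; testing \<open>S \<eta>\<close> at \<open>\<theta>\<close>, with the
  Lipschitz estimate, bounds it above by a quadratic.\<close>

lemma conjugate_reg_has_derivative:
  assumes S: "is_sparsemap (sparsemap_reg_high V Y) Y S"
    and yi: "yi \<in> convex hull Y"
    and growth: "\<And>y. y \<in> convex hull Y \<Longrightarrow>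
      1/2 * (norm (yi - y))\<^sup>2 \<le> objective V \<theta> yi - objective V \<theta> y"
  shows "((\<lambda>\<eta>. real_of_ereal (conjugate_reg (sparsemap_reg_high V Y) Y \<eta>))
    has_derivative (\<lambda>h. yi \<bullet> h)) (at \<theta>)"
proof -
  define W where "W \<eta> = objective V \<eta> (S \<eta>)" for \<eta>
  have W\<theta>: "W \<theta> = objective V \<theta> yi"
    using sparsemap_eq_of_growth[OF assms] by (simp add: W_def)
  have bound: "norm (W \<eta> - W \<theta> - yi \<bullet> (\<eta> - \<theta>)) \<le> (2 * norm (\<eta> - \<theta>)) * norm (\<eta> - \<theta>)" for \<eta>
  proof -
    have "objective V \<eta> yi \<le> W \<eta>"
      unfolding W_def by (rule is_sparsemapD(2)[OF S yi])
    then have lower: "0 \<le> W \<eta> - W \<theta> - yi \<bullet> (\<eta> - \<theta>)"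
      unfolding W\<theta> objective_def by (simp add: inner_diff_right inner_commute)
    have "objective V \<theta> (S \<eta>) \<le> W \<theta>"
      unfolding W_def by (rule is_sparsemapD[OF S])+
    then have "W \<eta> - W \<theta> - yi \<bullet> (\<eta> - \<theta>) \<le> (S \<eta> - yi) \<bullet> (\<eta> - \<theta>)"
      unfolding W_def objective_def by (simp add: inner_diff_right inner_diff_left inner_commute)
    also have "\<dots> \<le> norm (S \<eta> - yi) * norm (\<eta> - \<theta>)" by (rule norm_cauchy_schwarz)
    also have "\<dots> \<le> (2 * norm (\<eta> - \<theta>)) * norm (\<eta> - \<theta>)"
      by (intro mult_right_mono sparsemap_lipschitz_of_growth[OF assms]) auto
    finally show ?thesis using lower by simp
  qed
  have "(W has_derivative (\<lambda>h. yi \<bullet> h)) (at \<theta>)"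
  proof (rule has_derivativeI_sandwich[of 1])
    show "norm (W \<eta> - W \<theta> - yi \<bullet> (\<eta> - \<theta>)) / norm (\<eta> - \<theta>) \<le> 2 * norm (\<eta> - \<theta>)"
      if "\<eta> \<noteq> \<theta>" for \<eta>
      using bound[of \<eta>] that by (simp add: pos_divide_le_eq)
    show "((\<lambda>\<eta>. 2 * norm (\<eta> - \<theta>)) \<longlongrightarrow> 0) (at \<theta>)"
      by (auto intro!: tendsto_eq_intros)
  qed (auto intro: bounded_linear_inner_right)
  then show ?thesis
    by (simp add: W_def[abs_def] conjugate_reg_eq[OF S])
qed

text \<open>By the chain rule the gradient is \<open>q - transpose X *v y\<close>, since
  \<open>\<beta>\<close> cancels its inverse.\<close>

lemma hopfield_energy_stationary:
  fixes X :: "real ^ 'd ^ 'l"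
  assumes conj: "((\<lambda>\<eta>. real_of_ereal (conjugate_reg \<Omega> Y \<eta>)) has_derivative (\<lambda>h. y \<bullet> h))
      (at (\<beta> *\<^sub>R (X *v q)))"
    and q: "q = transpose X *v y"
    and "\<beta> \<noteq> 0"
  shows "stationary_point (hopfield_energy \<Omega> Y \<beta> X) q"
proof -
  have lin: "((\<lambda>q. \<beta> *\<^sub>R (X *v q)) has_derivative (\<lambda>h. \<beta> *\<^sub>R (X *v h))) (at q)"
    by (intro derivative_intros bounded_linear_imp_has_derivative
        matrix_vector_mul_bounded_linear)
  have "((\<lambda>q. - inverse \<beta> * real_of_ereal (conjugate_reg \<Omega> Y (\<beta> *\<^sub>R (X *v q))) + 1/2 * (q \<bullet> q))
    has_derivative (\<lambda>h. - inverse \<beta> * (y \<bullet> (\<beta> *\<^sub>R (X *v h))) + 1/2 * (q \<bullet> h + h \<bullet> q))) (at q)"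
    by (intro derivative_intros has_derivative_compose[OF lin conj])
  moreover have "- inverse \<beta> * (y \<bullet> (\<beta> *\<^sub>R (X *v h))) + 1/2 * (q \<bullet> h + h \<bullet> q) = 0" for h
  proof -
    have "q \<bullet> h = y \<bullet> (X *v h)" unfolding q by (rule inner_transpose_mult)
    then show ?thesis using \<open>\<beta> \<noteq> 0\<close> by (simp add: inner_commute[of h])
  qed
  ultimately show ?thesis
    by (simp add: stationary_point_def hopfield_energy_def[abs_def] power2_norm_eq_inner)
qed

section \<open>Norm bounds for the transposed map, and the separation\<close>

lemma norm_transpose_mult_le_spectral:
  "norm (transpose X *v v) \<le> spectral_norm X * norm v" for X :: "real ^ 'd ^ 'l"
proof -
  let ?u = "transpose X *v v"
  \<comment> \<open>Moving the transpose across the inner product leaves \<open>X\<close> acting on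
    \<open>?u\<close>, where \<open>onorm\<close> applies; one factor \<open>norm ?u\<close> then
    cancels.\<close>
  have "norm ?u * norm ?u = v \<bullet> (X *v ?u)"
    by (metis inner_transpose_mult power2_eq_square power2_norm_eq_inner)
  also have "\<dots> \<le> norm v * norm (X *v ?u)" by (rule norm_cauchy_schwarz)
  also have "\<dots> \<le> norm v * (spectral_norm X * norm ?u)"
    unfolding spectral_norm_def
    by (intro mult_left_mono onorm matrix_vector_mul_bounded_linear) auto
  finally have "norm ?u * norm ?u \<le> (spectral_norm X * norm v) * norm ?u" by (simp add: ac_simps)
  then show ?thesis
    by (cases "?u = 0")
      (auto simp: mult_le_cancel_right spectral_norm_def
        intro!: mult_nonneg_nonneg onorm_pos_le matrix_vector_mul_bounded_linear)
qed

text \<open>For entries in {-1, 0, 1} absolute values equal squares, so the sum of absolute values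
  is the squared Euclidean norm.\<close>

lemma norm_transpose_mult_le_rows:
  fixes X :: "real ^ 'd ^ 'l"
  assumes "\<And>k. v $ k \<in> {-1, 0, 1}"
  shows "norm (transpose X *v v) \<le> max_row_norm X * (norm v)\<^sup>2"
proof -
  have "transpose X *v v = (\<Sum>k\<in>UNIV. v $ k *\<^sub>R row k X)"
    by (simp add: vec_eq_iff matrix_vector_mult_def transpose_def row_def mult.commute)
  also have "norm \<dots> \<le> (\<Sum>k\<in>UNIV. \<bar>v $ k\<bar> * norm (row k X))"
    by (rule order_trans[OF norm_sum]) simp
  also have "\<dots> \<le> (\<Sum>k\<in>UNIV. v $ k * v $ k * max_row_norm X)"
  proof (rule sum_mono)
    fix k
    have "\<bar>v $ k\<bar> = v $ k * v $ k" using assms[of k] by auto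
    moreover have "norm (row k X) \<le> max_row_norm X" by (simp add: max_row_norm_def)
    ultimately show "\<bar>v $ k\<bar> * norm (row k X) \<le> v $ k * v $ k * max_row_norm X"
      by (simp add: mult_left_mono)
  qed
  also have "\<dots> = max_row_norm X * (norm v)\<^sup>2"
    by (simp add: power2_norm_eq_inner inner_vec_def sum_distrib_right mult.commute
        flip: sum_distrib_left)
  finally show ?thesis .
qed

lemma norm_le_max_dist: "finite Y \<Longrightarrow> y' \<in> Y \<Longrightarrow> norm (y - y') \<le> max_dist Y y"
  by (simp add: max_dist_def)

lemma separation_le:
  fixes X :: "real ^ 'd ^ 'l"
  assumes "finite Y" "y' \<in> Y - {y}"
  shows "separation Y X y \<le> (transpose X *v y) \<bullet> (transpose X *v (y - y'))"
proof -
  have gram: "y \<bullet> ((X ** transpose X) *v z) = (transpose X *v y) \<bullet> (transpose X *v z)" for z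
    by (simp only: inner_transpose_mult matrix_vector_mul_assoc)
  have "y \<bullet> ((X ** transpose X) *v y') \<le> Max ((\<lambda>y'. y \<bullet> ((X ** transpose X) *v y')) ` (Y - {y}))"
    using assms by (intro Max_ge) auto
  then show ?thesis
    unfolding separation_def gram by (simp add: matrix_vector_mult_diff_distrib inner_diff_right)
qed

text \<open>Every convergence claim reduces to a margin condition on the query, under which one
  update yields \<open>transpose X *v yi\<close>. The separation gives it at the pattern itself,
  claim (2) assumes it, and claim (3) obtains it by perturbation.\<close>

theorem proposition5:
  fixes Y :: "(real ^ 'l) set"
    and X :: "real ^ 'd ^ 'l"
    and \<Omega> :: "real ^ 'l \<Rightarrow> ereal"
    and S :: "real ^ 'l \<Rightarrow> real ^ 'l"
    and yi :: "real ^ 'l"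
    and r \<beta> :: real
  assumes "\<forall>y\<in>Y. \<forall>k. y $ k \<in> {0, 1}"
    and "card Y \<ge> 2"
    and "r > 0"
    and "\<forall>y\<in>Y. norm y = r"
    and "\<Omega> = sparsemap_reg Y \<or>
         (\<exists>V F rV rF. V \<union> F = UNIV \<and> V \<inter> F = {} \<and> \<Omega> = sparsemap_reg_high V Y \<and>
            (\<forall>y\<in>Y. norm (block V y) = rV \<and> norm (block F y) = rF) \<and> rV\<^sup>2 + rF\<^sup>2 = r\<^sup>2)"
    and "is_sparsemap \<Omega> Y S"
    and "\<beta> > 0"
    and "yi \<in> Y"
    and "separation Y X yi \<ge> (max_dist Y yi)\<^sup>2 / (2 * \<beta>)"
  shows "(\<forall>y\<in>Y. max_dist Y y \<le> 2 * r) \<and>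
    (stationary_point (hopfield_energy \<Omega> Y \<beta> X) (transpose X *v yi) \<and>
      transpose X *v yi = transpose X *v S (\<beta> *\<^sub>R (X *v (transpose X *v yi)))) \<and>
    (\<forall>q. hopfield_updates S \<beta> X q \<and>
      (\<forall>y\<in>Y - {yi}. q 0 \<bullet> (transpose X *v (yi - y)) \<ge> (max_dist Y yi)\<^sup>2 / (2 * \<beta>)) \<longrightarrow>
      (\<forall>t\<ge>1. q t = transpose X *v yi)) \<and>
    (\<forall>\<epsilon>\<ge>0. separation Y X yi \<ge> (max_dist Y yi)\<^sup>2 / (2 * \<beta>) +
        \<epsilon> * min (spectral_norm X * max_dist Y yi) (max_row_norm X * (max_dist Y yi)\<^sup>2) \<longrightarrow>
      (\<forall>q. hopfield_updates S \<beta> X q \<and> norm (q 0 - transpose X *v yi) \<le> \<epsilon> \<longrightarrow>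
        (\<forall>t\<ge>1. q t = transpose X *v yi)))"
proof -
  \<comment> \<open>Infinite sets have \<open>card\<close> 0.\<close>
  have fin: "finite Y" using assms(2) by (rule card_ge_0_finite[OF less_le_trans[rotated]]) simp
  \<comment> \<open>In case (a), \<open>V = UNIV\<close> and \<open>rV = r\<close>.\<close>
  obtain V rV where \<Omega>: "\<Omega> = sparsemap_reg_high V Y"
    and norm_block: "\<And>y. y \<in> Y \<Longrightarrow> norm (block V y) = rV"
    using assms(4,5) by (auto simp: sparsemap_reg_eq_high block_UNIV)
  note S = assms(6)[unfolded \<Omega>]
  let ?D = "max_dist Y yi" and ?p = "transpose X *v yi"
  have hull: "yi \<in> convex hull Y" using assms(8) by (rule hull_inc)
  have growth: "1/2 * (norm (yi - y))\<^sup>2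
      \<le> objective V (\<beta> *\<^sub>R (X *v q)) yi - objective V (\<beta> *\<^sub>R (X *v q)) y"
    if q: "\<forall>y\<in>Y - {yi}. q \<bullet> (transpose X *v (yi - y)) \<ge> ?D\<^sup>2 / (2 * \<beta>)"
      and y: "y \<in> convex hull Y" for q y
  proof (rule objective_quadratic_growth[OF norm_block assms(8) norm_le_max_dist[OF fin] _ y])
    fix z assume "z \<in> Y - {yi}"
    with q have "?D\<^sup>2 / (2 * \<beta>) \<le> q \<bullet> (transpose X *v (yi - z))" by blast
    also have "\<dots> = (X *v q) \<bullet> (yi - z)"
      by (metis inner_commute inner_transpose_mult)
    finally show "?D\<^sup>2 / 2 \<le> (\<beta> *\<^sub>R (X *v q)) \<bullet> (yi - z)"
      using assms(7) by (simp add: field_simps)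
  qed
  have map: "hopfield_map S \<beta> X q = ?p"
    if "\<forall>y\<in>Y - {yi}. q \<bullet> (transpose X *v (yi - y)) \<ge> ?D\<^sup>2 / (2 * \<beta>)" for q
    unfolding hopfield_map_def using sparsemap_eq_of_growth[OF S hull growth[OF that]] by simp
  have p: "\<forall>y\<in>Y - {yi}. ?p \<bullet> (transpose X *v (yi - y)) \<ge> ?D\<^sup>2 / (2 * \<beta>)"
    using separation_le[OF fin, of _ yi X] assms(9) by force
  have one_step: "\<forall>t\<ge>1. q t = ?p"
    if upd: "hopfield_updates S \<beta> X q"
      and q: "\<forall>y\<in>Y - {yi}. q 0 \<bullet> (transpose X *v (yi - y)) \<ge> ?D\<^sup>2 / (2 * \<beta>)" for q
  proof -
    \<comment> \<open>The first update uses the margin at \<open>q 0\<close>, each later one the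
      margin at \<open>?p\<close>.\<close>
    have "q (Suc t) = ?p" for t
      by (induction t) (use upd map[OF q] map[OF p] in \<open>auto simp: hopfield_updates_def\<close>)
    then show ?thesis by (metis One_nat_def Suc_le_D)
  qed
  have diam: "max_dist Y y \<le> 2 * r" if "y \<in> Y" for y
  proof -
    have "norm (y - z) \<le> 2 * r" if "z \<in> Y" for z
      using norm_triangle_ineq4[of y z] assms(4) \<open>y \<in> Y\<close> that by auto
    then show ?thesis unfolding max_dist_def using fin that by (subst Max_le_iff) auto
  qed
  have stationary: "stationary_point (hopfield_energy \<Omega> Y \<beta> X) ?p"
    unfolding \<Omega> using assms(7)
    by (intro hopfield_energy_stationary[OF conjugate_reg_has_derivative[OF S hull growth[OF p]] refl])
      auto
  \<comment> \<open>Moving from \<open>?p\<close> to \<open>q\<close> costs at most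
    \<open>\<epsilon> * norm ?w\<close> of the margin, and both terms of the minimum bound
    \<open>norm ?w\<close> after scaling.\<close>
  have ball: "\<forall>y\<in>Y - {yi}. q \<bullet> (transpose X *v (yi - y)) \<ge> ?D\<^sup>2 / (2 * \<beta>)"
    if "\<epsilon> \<ge> 0" and sep: "separation Y X yi \<ge> ?D\<^sup>2 / (2 * \<beta>) +
        \<epsilon> * min (spectral_norm X * ?D) (max_row_norm X * ?D\<^sup>2)"
      and q: "norm (q - ?p) \<le> \<epsilon>" for \<epsilon> q
  proof
    fix y assume y: "y \<in> Y - {yi}"
    let ?w = "transpose X *v (yi - y)"
    have d: "norm (yi - y) \<le> ?D" using norm_le_max_dist[OF fin] y by blast
    have spectral: "norm ?w \<le> spectral_norm X * ?D"
      by (rule order_trans[OF norm_transpose_mult_le_spectral])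
        (auto simp: spectral_norm_def
          intro!: mult_left_mono d onorm_pos_le matrix_vector_mul_bounded_linear)
    \<comment> \<open>An arbitrary row index serves to show that the maximum is nonnegative.\<close>
    have "0 \<le> norm (row undefined X)" by simp
    also have "\<dots> \<le> max_row_norm X" by (simp add: max_row_norm_def)
    finally have M: "0 \<le> max_row_norm X" .
    have "(yi - y) $ k \<in> {-1, 0, 1}" for k
    proof -
      have "yi $ k \<in> {0, 1}" "y $ k \<in> {0, 1}" using assms(1,8) y by blast+
      then show ?thesis by auto
    qed
    then have "norm ?w \<le> max_row_norm X * ?D\<^sup>2"
      by (rule order_trans[OF norm_transpose_mult_le_rows])
        (auto intro!: mult_left_mono power_mono d M)
    with spectral have "norm (q - ?p) * norm ?w
        \<le> \<epsilon> * min (spectral_norm X * ?D) (max_row_norm X * ?D\<^sup>2)"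
      using q \<open>\<epsilon> \<ge> 0\<close> by (intro mult_mono) auto
    moreover have "\<bar>(q - ?p) \<bullet> ?w\<bar> \<le> norm (q - ?p) * norm ?w" by (rule Cauchy_Schwarz_ineq2)
    ultimately show "?D\<^sup>2 / (2 * \<beta>) \<le> q \<bullet> ?w"
      using sep separation_le[OF fin y, of X] by (simp add: inner_diff_left)
  qed
  show ?thesis
    using diam stationary map[OF p, unfolded hopfield_map_def, symmetric] one_step ball
    by (intro conjI) blast+
qed

end
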